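(* For every real $t$ with $0\le t\le 1$, all of the following hold: (1) $\displaystyle \chi_3(t)=\int_0^1\frac{\sin^{-1}(tx)\cos^{-1}x}{x}\,dx$; (2) $\displaystyle \frac18\mathrm{Li}_3(t^2)=\frac2\pi\int_0^1\frac{\frac12(\sin^{-1}(tx))^2\cos^{-1}x}{x}\,dx$; (3) $\displaystyle \mathrm{Li}_3(t)=\int_0^1\frac{\left(\sin^{-1}(tx)+\frac1\pi(\sin^{-1}(tx))^2\right)\cos^{-1}x}{x}\,dx$; (4) $\displaystyle \mathrm{Ti}_3(t)=\int_0^1\frac{\sinh^{-1}(tx)\cos^{-1}x}{x}\,dx$; (5) $\displaystyle \frac\pi2\left(\frac18\mathrm{Li}_3(t^2)-\frac1{32}\mathrm{Li}_3(t^4)\right)=\int_0^1\frac{\frac12(\sinh^{-1}(tx))^2\cos^{-1}x}{x}\,dx$.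
   Context: For $0\le t\le 1$: $\mathrm{Li}_3(t)=\sum_{n=1}^\infty \frac{t^n}{n^3}$ (trilogarithm), $\chi_3(t)=\sum_{n=1}^\infty\frac{t^{2n-1}}{(2n-1)^3}$ (Legendre $\chi$ function of order 3), and $\mathrm{Ti}_3(t)=\sum_{n=1}^\infty\frac{(-1)^{n-1}}{(2n-1)^3}t^{2n-1}$. Here $\sin^{-1}$ is the real inverse sine with values in $[-\pi/2,\pi/2]$, $\cos^{-1}$ is the real inverse cosine with values in $[0,\pi]$, and $\sinh^{-1}x=\log(x+\sqrt{x^2+1})$ is the inverse hyperbolic sine. *)

theory Defs
  imports "HOL-Analysis.Analysis"
begin

text \<open>The sums over \<open>n \<ge> 1\<close> are reindexed to start at \<open>0\<close>. All three series converge
  absolutely for \<open>0 \<le> t \<le> 1\<close>, the only arguments considered.\<close>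

definition Li3 :: "real \<Rightarrow> real" where
  "Li3 t = (\<Sum>n. t ^ (n + 1) / real (n + 1) ^ 3)"

definition chi3 :: "real \<Rightarrow> real" where
  "chi3 t = (\<Sum>n. t ^ (2 * n + 1) / real (2 * n + 1) ^ 3)"

definition Ti3 :: "real \<Rightarrow> real" where
  "Ti3 t = (\<Sum>n. (-1) ^ n / real (2 * n + 1) ^ 3 * t ^ (2 * n + 1))"

end

theory Submission
  imports Defs
begin

text \<open>
  All five formulas come from integrating one power series term by term. Write \<open>F\<close> for
  \<open>arcsin\<close> (with \<open>s = 1\<close>) or \<open>arsinh\<close> (with \<open>s = -1\<close>); in both cases \<open>F 0 = 0\<close> and
  \<open>F' y = 1 / sqrt (1 - s y\<^sup>2)\<close>. The function \<open>S = p F + c F\<^sup>2 / 2\<close> solves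
  \<open>(1 - s y\<^sup>2) S'' - s y S' = c\<close>, so its Taylor coefficients \<open>a\<close> satisfy the two-step recursion
  \<open>(n+1) (n+2) a\<^bsub>n+2\<^esub> = s n\<^sup>2 a\<^bsub>n\<^esub>\<close> for \<open>n \<ge> 1\<close>. The moments \<open>M n\<close>, the integrals of
  \<open>x ^ n * arccos x\<close> over the unit interval, satisfy a two-step recursion as well, namely
  \<open>(n+3)\<^sup>2 M (n+2) = (n+1) (n+2) M n\<close>.

  The quadratic factors cancel in the product: \<open>a\<^bsub>n+1\<^esub> M n = b\<^bsub>n+1\<^esub> / (n+1)\<^sup>3\<close>,
  where raising the index by two multiplies \<open>b\<close> by \<open>s\<close> (\<open>arc_coeff_mult_arccos_moment\<close>). Thus the
  integral of \<open>S (t x) * arccos x / x\<close> is the sum of \<open>b\<^bsub>n\<^esub> t\<^sup>n / n\<^sup>3\<close> over \<open>n \<ge> 1\<close>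
  (\<open>has_integral_arc_quadratic\<close>). The choice \<open>p = 1, c = 0\<close> keeps the odd \<open>n\<close> and gives \<open>chi3\<close>
  and \<open>Ti3\<close>; the choice \<open>p = 0, c = 1\<close> keeps the even \<open>n\<close> and gives \<open>Li3 (t\<^sup>2)\<close> and its
  alternating counterpart; for \<open>s = 1\<close> the choice \<open>p = 1, c = 2 / pi\<close> makes \<open>b\<close> constantly
  \<open>1\<close> and gives \<open>Li3 t\<close>.
\<close>

section \<open>Moments of the inverse cosine\<close>

definition arccos_moment :: "nat \<Rightarrow> real" where
  "arccos_moment n = integral {0..1} (\<lambda>x. x ^ n * arccos x)"

lemma continuous_on_power_arccos:
  "continuous_on {0..1} (\<lambda>x::real. x ^ n * arccos x)"
  by (intro continuous_intros) auto

lemma has_integral_arccos_moment: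
  "((\<lambda>x. x ^ n * arccos x) has_integral arccos_moment n) {0..1}"
  unfolding arccos_moment_def
  by (intro integrable_integral integrable_continuous_interval continuous_on_power_arccos)

lemma arccos_moment_0: "arccos_moment 0 = 1"
proof -
  have "((\<lambda>x::real. x ^ 0 * arccos x) has_integral
      ((1 * arccos 1 - sqrt (1 - 1\<^sup>2)) - (0 * arccos 0 - sqrt (1 - 0\<^sup>2)))) {0..1}"
  proof (rule fundamental_theorem_of_calculus_interior)
    fix x :: real assume x: "x \<in> {0<..<1}"
    then have "x\<^sup>2 < 1" by (simp add: power_less_one_iff)
    then have "((\<lambda>x. x * arccos x - sqrt (1 - x\<^sup>2)) has_real_derivative x ^ 0 * arccos x) (at x)"
      using x by (auto intro!: derivative_eq_intros simp: field_simps)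
    then show "((\<lambda>x. x * arccos x - sqrt (1 - x\<^sup>2)) has_vector_derivative x ^ 0 * arccos x) (at x)"
      by (simp add: has_real_derivative_iff_has_vector_derivative)
  qed (auto intro!: continuous_intros)
  from has_integral_unique[OF has_integral_arccos_moment this] show ?thesis by simp
qed

text \<open>
  Integration by parts leaves half the integral of \<open>x\<^sup>2 / sqrt (1 - x\<^sup>2)\<close>, whose primitive is
  \<open>- (arccos x + x * sqrt (1 - x\<^sup>2)) / 2\<close>.
\<close>
lemma arccos_moment_1: "arccos_moment 1 = pi / 8"
proof -
  let ?G = "\<lambda>x::real. x\<^sup>2 * arccos x / 2 - (arccos x + x * sqrt (1 - x\<^sup>2)) / 4"
  have "((\<lambda>x::real. x ^ 1 * arccos x) has_integral (?G 1 - ?G 0)) {0..1}"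
  proof (rule fundamental_theorem_of_calculus_interior)
    fix x :: real assume x: "x \<in> {0<..<1}"
    then have x2: "1 - x\<^sup>2 > 0" by (simp add: power_less_one_iff)
    define r where "r = sqrt (1 - x\<^sup>2)"
    have r: "r > 0" "r\<^sup>2 = 1 - x\<^sup>2" using x2 by (auto simp: r_def)
    have "(?G has_real_derivative
        (x * arccos x - x\<^sup>2 / r / 2) - (- (1 / r) + (r - x\<^sup>2 / r)) / 4) (at x)"
      using x x2 unfolding r_def
      by (auto intro!: derivative_eq_intros simp: field_simps power2_eq_square)
    also have "(x * arccos x - x\<^sup>2 / r / 2) - (- (1 / r) + (r - x\<^sup>2 / r)) / 4
        = x * arccos x - (r\<^sup>2 - (1 - x\<^sup>2)) / (4 * r)"
      using r(1) by (simp add: field_simps power2_eq_square)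
    also have "\<dots> = x ^ 1 * arccos x" using r by simp
    finally show "(?G has_vector_derivative x ^ 1 * arccos x) (at x)"
      by (simp add: has_real_derivative_iff_has_vector_derivative)
  qed (auto intro!: continuous_intros)
  from has_integral_unique[OF has_integral_arccos_moment this] show ?thesis by simp
qed

text \<open>
  The difference of the two sides is the integral of the derivative of
  \<open>(n+3) x\<^bsup>n+3\<^esup> arccos x - (n+2) x\<^bsup>n+1\<^esup> arccos x - x\<^bsup>n+2\<^esup> sqrt (1 - x\<^sup>2)\<close>,
  which vanishes at both end points. The first two summands undo an integration by parts of each
  moment; the last one is the reduction formula for the remaining integrals of
  \<open>x\<^sup>k / sqrt (1 - x\<^sup>2)\<close>.
\<close>
lemma arccos_moment_rec:
  "real (n + 3) ^ 2 * arccos_moment (n + 2) = real (n + 1) * real (n + 2) * arccos_moment n"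
proof -
  let ?G = "\<lambda>x::real. real (n + 3) * x ^ (n + 3) * arccos x
              - real (n + 2) * x ^ (n + 1) * arccos x - x ^ (n + 2) * sqrt (1 - x\<^sup>2)"
  let ?f = "\<lambda>x::real. real (n + 3) ^ 2 * (x ^ (n + 2) * arccos x)
              - real (n + 1) * real (n + 2) * (x ^ n * arccos x)"
  have "(?f has_integral (?G 1 - ?G 0)) {0..1}"
  proof (rule fundamental_theorem_of_calculus_interior)
    fix x :: real assume x: "x \<in> {0<..<1}"
    then have x2: "1 - x\<^sup>2 > 0" by (simp add: power_less_one_iff)
    define r where "r = sqrt (1 - x\<^sup>2)"
    have r: "r > 0" "r\<^sup>2 = 1 - x\<^sup>2" using x2 by (auto simp: r_def)
    have arccos': "(arccos has_real_derivative - (1 / r)) (at x)"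
      using x x2 unfolding r_def by (auto intro!: derivative_eq_intros simp: field_simps)
    have sqrt': "((\<lambda>x. sqrt (1 - x\<^sup>2)) has_real_derivative - (x / r)) (at x)"
      using x2 unfolding r_def by (auto intro!: derivative_eq_intros simp: field_simps)
    have "(?G has_real_derivative
         (real (n + 3) * (real (n + 3) * x ^ (n + 2) * arccos x - x ^ (n + 3) / r)
        - real (n + 2) * (real (n + 1) * x ^ n * arccos x - x ^ (n + 1) / r)
        - (real (n + 2) * x ^ (n + 1) * r - x ^ (n + 2) * x / r))) (at x)"
      by (rule DERIV_cong[OF DERIV_diff[OF DERIV_diff[OF
            DERIV_mult[OF DERIV_cmult[OF DERIV_pow] arccos']
            DERIV_mult[OF DERIV_cmult[OF DERIV_pow] arccos']]
            DERIV_mult[OF DERIV_pow sqrt']]])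
         (simp add: r_def[symmetric] algebra_simps add_divide_distrib)
    \<comment> \<open>Everything beyond the integrand is a multiple of \<open>r\<^sup>2 - (1 - x\<^sup>2)\<close>.\<close>
    also have "(real (n + 3) * (real (n + 3) * x ^ (n + 2) * arccos x - x ^ (n + 3) / r)
        - real (n + 2) * (real (n + 1) * x ^ n * arccos x - x ^ (n + 1) / r)
        - (real (n + 2) * x ^ (n + 1) * r - x ^ (n + 2) * x / r))
        = ?f x - real (n + 2) * x ^ (n + 1) * (r\<^sup>2 - (1 - x\<^sup>2)) / r"
      using r(1) by (simp add: field_simps power_add power2_eq_square power3_eq_cube)
    also have "\<dots> = ?f x" using r by simp
    finally show "(?G has_vector_derivative ?f x) (at x)"
      by (simp add: has_real_derivative_iff_has_vector_derivative)
  qed (auto intro!: continuous_intros)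
  moreover have "(?f has_integral (real (n + 3) ^ 2 * arccos_moment (n + 2)
      - real (n + 1) * real (n + 2) * arccos_moment n)) {0..1}"
    by (intro has_integral_diff has_integral_mult_right has_integral_arccos_moment)
  ultimately have "?G 1 - ?G 0 = real (n + 3) ^ 2 * arccos_moment (n + 2)
      - real (n + 1) * real (n + 2) * arccos_moment n"
    by (rule has_integral_unique)
  then show ?thesis by (simp add: zero_power)
qed

section \<open>The power series of a quadratic polynomial in an inverse sine\<close>

text \<open>
  The Taylor coefficients of the solution of \<open>(1 - s y\<^sup>2) S'' - s y S' = c\<close> with \<open>S 0 = 0\<close> and
  \<open>S' 0 = p\<close>. For \<open>s = 1\<close> and \<open>c = 0\<close> they are \<open>p\<close> times those of \<open>arcsin\<close>.
\<close>
fun arc_coeff :: "real \<Rightarrow> real \<Rightarrow> real \<Rightarrow> nat \<Rightarrow> real" where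
  "arc_coeff s p c 0 = 0"
| "arc_coeff s p c (Suc 0) = p"
| "arc_coeff s p c (Suc (Suc n)) =
     (s * real n ^ 2 * arc_coeff s p c n + (if n = 0 then c else 0))
       / (real (n + 1) * real (n + 2))"

lemma bounded_by_first_two:
  fixes f :: "nat \<Rightarrow> real"
  assumes "\<And>n. \<bar>f (n + 2)\<bar> \<le> \<bar>f n\<bar>"
  shows "\<bar>f n\<bar> \<le> max \<bar>f 0\<bar> \<bar>f 1\<bar>"
proof (induction n rule: induct_nat_012)
  case (ge2 n)
  then show ?case using assms[of n] by simp
qed auto

lemma abs_arc_coeff_le:
  assumes "\<bar>s\<bar> \<le> 1"
  shows "\<bar>arc_coeff s p c n\<bar> \<le> max \<bar>p\<bar> \<bar>c / 2\<bar>"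
proof (cases n)
  case (Suc k)
  have "\<bar>arc_coeff s p c (Suc (j + 2))\<bar> \<le> \<bar>arc_coeff s p c (Suc j)\<bar>" for j
  proof -
    have "real (Suc j) ^ 2 \<le> real (Suc j + 1) * real (Suc j + 2)"
      by (simp add: power2_eq_square algebra_simps)
    then have *: "\<bar>s\<bar> * (real (Suc j) ^ 2 / (real (Suc j + 1) * real (Suc j + 2))) \<le> 1"
      using assms by (intro mult_le_one) auto
    have "\<bar>arc_coeff s p c (Suc (j + 2))\<bar>
        = \<bar>s\<bar> * (real (Suc j) ^ 2 / (real (Suc j + 1) * real (Suc j + 2))) * \<bar>arc_coeff s p c (Suc j)\<bar>"
      by (simp add: abs_mult)
    also have "\<dots> \<le> 1 * \<bar>arc_coeff s p c (Suc j)\<bar>"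
      using * by (rule mult_right_mono) simp
    finally show ?thesis by simp
  qed
  from bounded_by_first_two[of "\<lambda>j. arc_coeff s p c (Suc j)", OF this, of k] Suc
  show ?thesis by simp
qed auto

lemma summable_arc_coeff:
  assumes "\<bar>s\<bar> \<le> 1" "\<bar>y\<bar> < 1"
  shows "summable (\<lambda>n. norm (arc_coeff s p c n * y ^ n))"
proof (rule summable_comparison_test')
  show "summable (\<lambda>n. max \<bar>p\<bar> \<bar>c / 2\<bar> * \<bar>y\<bar> ^ n)"
    using assms(2) by (intro summable_mult summable_geometric) simp
  show "norm (norm (arc_coeff s p c n * y ^ n)) \<le> max \<bar>p\<bar> \<bar>c / 2\<bar> * \<bar>y\<bar> ^ n" if "n \<ge> 0" for n
    using mult_right_mono[OF abs_arc_coeff_le[OF assms(1), of p c n], of "\<bar>y\<bar> ^ n"]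
    by (simp add: abs_mult power_abs)
qed

text \<open>
  The Euler operator \<open>y d/dy\<close> multiplies the \<open>n\<close>-th coefficient by \<open>n\<close>. Applied twice it
  produces the factor \<open>n\<^sup>2\<close> in the recursion for \<^const>\<open>arc_coeff\<close> without any index shift.
\<close>
lemma mult_suminf_diffs:
  fixes y :: real
  assumes "summable (\<lambda>n. diffs a n * y ^ n)"
  shows "(\<lambda>n. real n * a n * y ^ n) sums (y * (\<Sum>n. diffs a n * y ^ n))"
proof -
  have "(\<lambda>n. y * (real n * a n * y ^ (n - Suc 0))) sums (y * (\<Sum>n. diffs a n * y ^ n))"
    using diffs_equiv[OF assms] by (intro sums_mult) simp
  also have "(\<lambda>n. y * (real n * a n * y ^ (n - Suc 0))) = (\<lambda>n. real n * a n * y ^ n)"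
  proof
    show "y * (real n * a n * y ^ (n - Suc 0)) = real n * a n * y ^ n" for n
      by (cases n) auto
  qed
  finally show ?thesis .
qed

text \<open>
  The recursion says that the sum \<open>S\<close> solves the differential equation, which in terms of \<open>F\<close> reads
  \<open>(sqrt (1 - s y\<^sup>2) S')' = c F'\<close>. Two integrations from \<open>0\<close> give first \<open>S' = (p + c F) F'\<close>
  and then \<open>S = p F + c F\<^sup>2 / 2\<close>.
\<close>
lemma arc_coeff_sums:
  fixes F :: "real \<Rightarrow> real"
  assumes s: "\<bar>s\<bar> \<le> 1" and F0: "F 0 = 0"
    and F': "\<And>y. \<bar>y\<bar> < 1 \<Longrightarrow> (F has_real_derivative 1 / sqrt (1 - s * y\<^sup>2)) (at y)"
    and x: "\<bar>x\<bar> < 1"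
  shows "(\<lambda>n. arc_coeff s p c n * x ^ n) sums (p * F x + c / 2 * (F x)\<^sup>2)"
proof -
  define a where "a = arc_coeff s p c"
  define S0 where "S0 y = (\<Sum>n. a n * y ^ n)" for y
  define S1 where "S1 y = (\<Sum>n. diffs a n * y ^ n)" for y
  define S2 where "S2 y = (\<Sum>n. diffs (diffs a) n * y ^ n)" for y
  define e where "e n = real n * a n" for n
  have sm0: "summable (\<lambda>n. a n * y ^ n)" if "norm y < 1" for y
    using summable_norm_cancel[OF summable_arc_coeff[OF s]] that unfolding a_def by simp
  have sm1: "summable (\<lambda>n. diffs a n * y ^ n)" if "norm y < 1" for y
    using termdiff_converges[OF that sm0] .
  have sm2: "summable (\<lambda>n. diffs (diffs a) n * y ^ n)" if "norm y < 1" for y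
    using termdiff_converges[OF that sm1] .
  have D0: "(S0 has_real_derivative S1 y) (at y)" if "norm y < 1" for y
    unfolding S0_def S1_def using termdiffs_strong'[OF sm0 that] by simp
  have D1: "(S1 has_real_derivative S2 y) (at y)" if "norm y < 1" for y
    unfolding S1_def S2_def using termdiffs_strong'[OF sm1 that] by simp
  have sume: "(\<lambda>n. e n * y ^ n) sums (y * S1 y)" if "norm y < 1" for y
    unfolding e_def S1_def by (rule mult_suminf_diffs[OF sm1[OF that]])
  have sme: "summable (\<lambda>n. e n * y ^ n)" if "norm y < 1" for y
    using sume[OF that] sums_summable by blast
  \<comment> \<open>The differential equation, with \<open>y S' + y\<^sup>2 S''\<close> written as \<open>y (y S')'\<close>.\<close>
  have ode: "S2 y = s * (y * (S1 y + y * S2 y)) + c" if y: "norm y < 1" for y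
  proof -
    have "((\<lambda>y. \<Sum>n. e n * y ^ n) has_real_derivative (\<Sum>n. diffs e n * y ^ n)) (at y)"
      by (rule termdiffs_strong'[OF sme y])
    moreover have "((\<lambda>y. \<Sum>n. e n * y ^ n) has_real_derivative (S1 y + y * S2 y)) (at y)"
    proof (rule has_field_derivative_transform_within_open)
      show "((\<lambda>y. y * S1 y) has_real_derivative (S1 y + y * S2 y)) (at y)"
        by (rule derivative_eq_intros D1[OF y] refl)+ simp
      show "open {-1<..<1::real}" "y \<in> {-1<..<1}" using y by auto
      show "z * S1 z = (\<Sum>n. e n * z ^ n)" if "z \<in> {-1<..<1}" for z
        using sums_unique[OF sume[of z]] that by auto
    qed
    ultimately have e': "(\<Sum>n. diffs e n * y ^ n) = S1 y + y * S2 y"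
      by (rule DERIV_unique)
    have "(\<lambda>n. real n * e n * y ^ n) sums (y * (S1 y + y * S2 y))"
      using mult_suminf_diffs[OF termdiff_converges[OF y sme]] e' by simp
    then have "(\<lambda>n. s * (real n * e n * y ^ n) + (if n = 0 then c else 0))
        sums (s * (y * (S1 y + y * S2 y)) + c)"
      using sums_single[of 0 "\<lambda>_. c"] by (intro sums_add sums_mult) auto
    also have "(\<lambda>n. s * (real n * e n * y ^ n) + (if n = 0 then c else 0))
        = (\<lambda>n. diffs (diffs a) n * y ^ n)"
    proof
      fix n
      have "diffs (diffs a) n = real (n + 1) * real (n + 2) * a (Suc (Suc n))"
        by (simp add: diffs_def algebra_simps)
      also have "\<dots> = s * real n ^ 2 * a n + (if n = 0 then c else 0)"
        unfolding a_def arc_coeff.simps times_divide_eq_right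
        by (rule nonzero_mult_div_cancel_left) simp
      finally show "s * (real n * e n * y ^ n) + (if n = 0 then c else 0)
          = diffs (diffs a) n * y ^ n"
        by (simp add: e_def power2_eq_square algebra_simps)
    qed
    finally show ?thesis unfolding S2_def by (simp add: sums_iff)
  qed
  have pos: "1 - s * y\<^sup>2 > 0" if "norm y < 1" for y
  proof -
    have "\<bar>s * y\<^sup>2\<bar> \<le> 1 * y\<^sup>2" unfolding abs_mult using s by (intro mult_mono) auto
    moreover have "y\<^sup>2 < 1" using that abs_square_less_1 by auto
    ultimately show ?thesis by linarith
  qed
  \<comment> \<open>The first integration; multiplying by the square root makes the left side a derivative.\<close>
  have S1_eq: "sqrt (1 - s * y\<^sup>2) * S1 y - c * F y = p" if y: "norm y < 1" for y
  proof -
    have "\<exists>k. \<forall>z\<in>{-1<..<1}. sqrt (1 - s * z\<^sup>2) * S1 z - c * F z = k"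
    proof (rule has_field_derivative_zero_constant)
      fix z :: real assume "z \<in> {-1<..<1}"
      then have z: "norm z < 1" by auto
      define r where "r = sqrt (1 - s * z\<^sup>2)"
      have r: "r > 0" "r\<^sup>2 = 1 - s * z\<^sup>2" using pos[OF z] by (auto simp: r_def)
      have "((\<lambda>z. sqrt (1 - s * z\<^sup>2) * S1 z - c * F z) has_real_derivative
          (- s * z / r * S1 z + r * S2 z - c * (1 / r))) (at z)"
        using pos[OF z] z unfolding r_def
        by (auto intro!: derivative_eq_intros D1[OF z] F' simp: field_simps)
      also have "- s * z / r * S1 z + r * S2 z - c * (1 / r)
          = (r\<^sup>2 * S2 z - s * z * S1 z - c) / r"
        using r(1) by (simp add: field_simps power2_eq_square)
      also have "r\<^sup>2 * S2 z - s * z * S1 z - c = 0" using ode[OF z] r(2) by algebra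
      also have "0 / r = 0" by simp
      finally show "((\<lambda>z. sqrt (1 - s * z\<^sup>2) * S1 z - c * F z) has_real_derivative 0)
          (at z within {-1<..<1})"
        by (rule has_field_derivative_at_within)
    qed auto
    then obtain k where k: "\<And>z. norm z < 1 \<Longrightarrow> sqrt (1 - s * z\<^sup>2) * S1 z - c * F z = k"
      by (auto simp: abs_less_iff)
    have "S1 0 = p" unfolding S1_def by (simp add: a_def diffs_def)
    then show ?thesis using k[OF y] k[of 0] F0 by simp
  qed
  have "\<exists>k. \<forall>z\<in>{-1<..<1}. S0 z - (p * F z + c / 2 * (F z)\<^sup>2) = k"
  proof (rule has_field_derivative_zero_constant)
    fix z :: real assume "z \<in> {-1<..<1}"
    then have z: "norm z < 1" by auto
    define r where "r = sqrt (1 - s * z\<^sup>2)"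
    have r: "r > 0" using pos[OF z] by (auto simp: r_def)
    have "((\<lambda>z. S0 z - (p * F z + c / 2 * (F z)\<^sup>2)) has_real_derivative
          (S1 z - (p * (1 / r) + c * F z * (1 / r)))) (at z)"
      using z unfolding r_def
      by (auto intro!: derivative_eq_intros D0[OF z] F')
    also have "S1 z - (p * (1 / r) + c * F z * (1 / r)) = 0"
      using S1_eq[OF z, folded r_def] r by (simp add: field_simps)
    finally show "((\<lambda>z. S0 z - (p * F z + c / 2 * (F z)\<^sup>2)) has_real_derivative 0)
          (at z within {-1<..<1})"
      by (rule has_field_derivative_at_within)
  qed auto
  then obtain k where k: "\<And>z. norm z < 1 \<Longrightarrow> S0 z - (p * F z + c / 2 * (F z)\<^sup>2) = k"
    by (auto simp: abs_less_iff)
  have "S0 0 = 0" unfolding S0_def by (simp add: a_def)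
  then have "S0 x = p * F x + c / 2 * (F x)\<^sup>2" using k[of x] k[of 0] x F0 by simp
  then show ?thesis using sm0[of x] x unfolding S0_def a_def by (simp add: sums_iff)
qed

section \<open>Termwise integration\<close>

text \<open>
  One step of both recursions multiplies the product by
  \<open>s (n+1)\<^sup>2 / ((n+2) (n+3))\<close> times \<open>(n+1) (n+2) / (n+3)\<^sup>2\<close>, that is, by
  \<open>s (n+1)\<^sup>3 / (n+3)\<^sup>3\<close>: this is where the cubes of the trilogarithm come from. The starting
  values are \<open>M 0 = 1\<close> and \<open>M 1 = pi / 8\<close>.
\<close>
lemma arc_coeff_mult_arccos_moment:
  assumes b1: "b 1 = p" and b2: "b 2 = pi / 2 * c"
    and b: "\<And>n. b (n + 3) = s * b (n + 1)"
  shows "arc_coeff s p c (n + 1) * arccos_moment n = b (n + 1) / real (n + 1) ^ 3"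
proof (induction n rule: induct_nat_012)
  case 0
  then show ?case using b1 by (simp add: arccos_moment_0)
next
  case 1
  have M1: "arccos_moment (Suc 0) = pi / 8" using arccos_moment_1 by (simp only: One_nat_def)
  have "arc_coeff s p c 2 = c / 2" by (simp add: numeral_2_eq_2)
  then show ?case by (simp add: M1 b2 numeral_2_eq_2[symmetric])
next
  case (ge2 n)
  define u where "u = real n + 1"
  have u: "u > 0" "real (n + 1) = u" "real (n + 2) = u + 1" "real (n + 3) = u + 2"
    by (auto simp: u_def)
  have a: "arc_coeff s p c (n + 3) = s * u\<^sup>2 * arc_coeff s p c (n + 1) / ((u + 1) * (u + 2))"
    using u by (simp add: eval_nat_numeral add_ac)
  have m: "arccos_moment (n + 2) = u * (u + 1) * arccos_moment n / (u + 2)\<^sup>2"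
    using arccos_moment_rec[of n] u(1) unfolding u(2-4) by (simp add: eq_divide_eq mult_ac)
  have "arc_coeff s p c (n + 3) * arccos_moment (n + 2)
      = s * u ^ 3 / (u + 2) ^ 3 * (arc_coeff s p c (n + 1) * arccos_moment n)"
    unfolding a m using u(1)
    by (simp add: divide_simps) (simp add: power2_eq_square power3_eq_cube algebra_simps)
  also have "\<dots> = s * b (n + 1) / (u + 2) ^ 3"
    unfolding ge2(1) using u by simp
  finally have "arc_coeff s p c (n + 3) * arccos_moment (n + 2) = b (n + 3) / real (n + 3) ^ 3"
    using b[of n] unfolding u(4) by simp
  then show ?case by (simp del: arc_coeff.simps add: eval_nat_numeral)
qed

lemma summable_div_cube:
  fixes c :: "nat \<Rightarrow> real"
  assumes "\<And>n. \<bar>c n\<bar> \<le> B"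
  shows "summable (\<lambda>n. c n / real (n + 1) ^ 3)"
proof (rule summable_comparison_test')
  have "summable (\<lambda>n. 1 / real (n + 1) ^ 3)"
    using inverse_power_summable[of 3, where ?'a = real]
      summable_iff_shift[of "\<lambda>n. inverse (real n ^ 3)" 1]
    by (simp add: field_simps)
  then show "summable (\<lambda>n. B * (1 / real (n + 1) ^ 3))" by (rule summable_mult)
  show "norm (c n / real (n + 1) ^ 3) \<le> B * (1 / real (n + 1) ^ 3)" for n
    using assms[of n] by (simp add: abs_divide divide_right_mono)
qed

text \<open>
  Summation and integration may be exchanged by dominated convergence: each term has constant sign
  on the unit interval, so the integrals of the absolute values are \<open>\<bar>b\<^bsub>n\<^esub>\<bar> t\<^sup>n / n\<^sup>3\<close>, and
  these are summable because \<open>b\<close> is bounded. The argument runs on the open interval. This excludes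
  the point \<open>x = 0\<close>, where the integrand has the value \<open>0\<close> of a division by zero instead
  of its limit, and the point \<open>x = 1\<close>, where for \<open>t = 1\<close> the series is evaluated on its
  circle of convergence.
\<close>
lemma has_integral_arc_quadratic:
  fixes F :: "real \<Rightarrow> real" and b :: "nat \<Rightarrow> real"
  assumes s: "\<bar>s\<bar> \<le> 1" and F0: "F 0 = 0"
    and F': "\<And>y. \<bar>y\<bar> < 1 \<Longrightarrow> (F has_real_derivative 1 / sqrt (1 - s * y\<^sup>2)) (at y)"
    and t: "0 \<le> t" "t \<le> 1"
    and b1: "b 1 = p" and b2: "b 2 = pi / 2 * c"
    and b: "\<And>n. b (n + 3) = s * b (n + 1)"
    and sums: "(\<lambda>n. b (n + 1) / real (n + 1) ^ 3 * t ^ (n + 1)) sums L"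
  shows "((\<lambda>x. (p * F (t * x) + c / 2 * (F (t * x))\<^sup>2) * arccos x / x) has_integral L) {0..1}"
proof -
  define a where "a = arc_coeff s p c"
  let ?f = "\<lambda>n x. a (n + 1) * t ^ (n + 1) * (x ^ n * arccos x)"
  let ?g = "\<lambda>x. (p * F (t * x) + c / 2 * (F (t * x))\<^sup>2) * arccos x / x"
  have moment: "set_integrable lborel {0<..<1} (\<lambda>x. x ^ n * arccos x)"
      "(LINT x:{0<..<1}|lborel. x ^ n * arccos x) = arccos_moment n" for n
  proof -
    have i: "set_integrable lborel {0..1} (\<lambda>x. x ^ n * arccos x)"
      by (rule borel_integrable_atLeastAtMost'[OF continuous_on_power_arccos])
    show i': "set_integrable lborel {0<..<1} (\<lambda>x. x ^ n * arccos x)"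
      by (rule set_integrable_subset[OF i]) auto
    show "(LINT x:{0<..<1}|lborel. x ^ n * arccos x) = arccos_moment n"
      using set_borel_integral_eq_integral(2)[OF i'] 
      by (simp add: arccos_moment_def integral_open_interval_real)
  qed
  have eq: "a (n + 1) * arccos_moment n = b (n + 1) / real (n + 1) ^ 3" for n
    unfolding a_def by (rule arc_coeff_mult_arccos_moment[OF b1 b2 b])
  let ?h = "\<lambda>n x. indicator {0<..<1} x *\<^sub>R ?f n x"
  have int: "integrable lborel (?h n)" for n
    using set_integrable_mult_right[OF moment(1)] unfolding set_integrable_def by blast
  have h_int: "(LINT x|lborel. ?h n x) = b (n + 1) / real (n + 1) ^ 3 * t ^ (n + 1)" for n
  proof -
    have "(LINT x|lborel. ?h n x) = (LINT x:{0<..<1}|lborel. ?f n x)"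
      by (simp only: set_lebesgue_integral_def)
    also have "\<dots> = a (n + 1) * t ^ (n + 1) * arccos_moment n"
      by (simp only: set_integral_mult_right moment(2))
    also have "\<dots> = b (n + 1) / real (n + 1) ^ 3 * t ^ (n + 1)"
      unfolding eq[of n, symmetric] by (simp only: mult_ac)
    finally show ?thesis .
  qed
  have norm_h: "norm (?h n x) = \<bar>a (n + 1) * t ^ (n + 1)\<bar> * (indicator {0<..<1} x *\<^sub>R (x ^ n * arccos x))" for n x
    by (auto simp: indicator_def abs_mult arccos_lbound)
  have m_nonneg: "arccos_moment n \<ge> 0" for n
    unfolding arccos_moment_def
    by (intro integral_nonneg integrable_continuous_interval continuous_on_power_arccos)
       (auto intro!: mult_nonneg_nonneg arccos_lbound)
  have norm_int: "(LINT x|lborel. norm (?h n x)) = \<bar>b (n + 1) / real (n + 1) ^ 3 * t ^ (n + 1)\<bar>" for n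
    using moment(2)[of n] eq[of n, symmetric] m_nonneg[of n]
    unfolding norm_h set_lebesgue_integral_def by (simp add: abs_mult)
  have "\<bar>b (Suc (n + 2))\<bar> \<le> \<bar>b (Suc n)\<bar>" for n
    using b[of n] s mult_right_mono[OF s, of "\<bar>b (Suc n)\<bar>"] by (simp add: abs_mult eval_nat_numeral)
  from bounded_by_first_two[of "\<lambda>n. b (Suc n)", OF this]
  obtain B where B: "\<And>n. \<bar>b (n + 1)\<bar> \<le> B" by auto
  have sm: "summable (\<lambda>n. LINT x|lborel. norm (?h n x))"
  proof -
    have "\<bar>\<bar>b (n + 1) * t ^ (n + 1)\<bar>\<bar> \<le> B * 1" for n
      unfolding abs_abs abs_mult power_abs using t B[of n]
      by (intro mult_mono power_le_one) auto
    from summable_div_cube[OF this] show ?thesis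
      unfolding norm_int by (simp add: abs_mult abs_divide)
  qed
  have pt: "(\<lambda>n. ?h n x) sums (indicator {0<..<1} x *\<^sub>R ?g x) \<and> summable (\<lambda>n. norm (?h n x))" for x
  proof (cases "x \<in> {0<..<1}")
    case True
    have tx: "\<bar>t * x\<bar> < 1"
    proof -
      have "t * x \<le> x" using True t by (intro mult_left_le_one_le) auto
      moreover have "t * x \<ge> 0" "x < 1" using True t by auto
      ultimately show ?thesis by linarith
    qed
    have hs: "?h n x = arccos x / x * (a (Suc n) * (t * x) ^ Suc n)" for n
      using True by (simp add: power_mult_distrib)
    have "(\<lambda>n. a n * (t * x) ^ n) sums (p * F (t * x) + c / 2 * (F (t * x))\<^sup>2)"
      unfolding a_def using arc_coeff_sums[OF s F0 F' tx] .
    then have "(\<lambda>n. a (Suc n) * (t * x) ^ Suc n) sums (p * F (t * x) + c / 2 * (F (t * x))\<^sup>2)"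
      by (subst sums_Suc_iff) (simp add: a_def)
    from sums_mult[OF this, of "arccos x / x"]
    have "(\<lambda>n. ?h n x) sums (indicator {0<..<1} x *\<^sub>R ?g x)"
      unfolding hs using True by (simp add: mult_ac)
    moreover have "summable (\<lambda>n. norm (?h n x))"
      unfolding hs norm_mult[of "arccos x / x"]
      by (intro summable_mult)
         (use summable_arc_coeff[OF s tx, of p c, THEN summable_Suc_iff[THEN iffD2]] in \<open>simp only: a_def\<close>)
    ultimately show ?thesis ..
  qed auto
  have AEs: "AE x in lborel. summable (\<lambda>n. norm (?h n x))" using pt by auto
  have g_eq: "(\<lambda>x. \<Sum>n. ?h n x) = (\<lambda>x. indicator {0<..<1} x *\<^sub>R ?g x)"
    using pt sums_unique by (metis (no_types, lifting))
  have g_int: "set_integrable lborel {0<..<1} ?g"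
    using integrable_suminf[OF int AEs sm] unfolding g_eq set_integrable_def .
  have "(LINT x:{0<..<1}|lborel. ?g x) = L"
    using integral_suminf[OF int AEs sm] sums unfolding g_eq h_int set_lebesgue_integral_def
    by (simp add: sums_iff)
  then have "(?g has_integral L) {0<..<1}"
    using set_borel_integral_eq_integral[OF g_int] by (simp add: has_integral_iff)
  then show ?thesis by (simp only: has_integral_Icc_iff_Ioo)
qed

section \<open>Odd and even parts\<close>

lemma sums_even_indices:
  fixes f :: "nat \<Rightarrow> real"
  assumes "(\<lambda>k. f (2 * k)) sums L" and "\<And>n. odd n \<Longrightarrow> f n = 0"
  shows "f sums L"
proof -
  have "f n = 0" if "n \<notin> range (\<lambda>k. 2 * k)" for n
    using that by (intro assms(2)) (auto elim: evenE)
  then show ?thesis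
    using assms(1) sums_mono_reindex[of "\<lambda>k. 2 * k" f L] by (simp add: strict_mono_def)
qed

lemma sums_odd_indices:
  fixes f :: "nat \<Rightarrow> real"
  assumes "(\<lambda>k. f (2 * k + 1)) sums L" and "\<And>n. even n \<Longrightarrow> f n = 0"
  shows "f sums L"
proof -
  have "f n = 0" if "n \<notin> range (\<lambda>k. 2 * k + 1)" for n
    using that by (intro assms(2)) (metis oddE rangeI)
  then show ?thesis
    using assms(1) sums_mono_reindex[of "\<lambda>k. 2 * k + 1" f L] by (simp add: strict_mono_def)
qed

text \<open>
  For \<open>p = 1\<close> and \<open>c = 0\<close> the two-step recursion for \<open>b\<close> starts from \<open>b 1 = 1\<close> and
  \<open>b 2 = 0\<close>, so only odd powers of \<open>t\<close> survive.
\<close>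
lemma has_integral_arc:
  fixes F :: "real \<Rightarrow> real"
  assumes s: "\<bar>s\<bar> \<le> 1" and F0: "F 0 = 0"
    and F': "\<And>y. \<bar>y\<bar> < 1 \<Longrightarrow> (F has_real_derivative 1 / sqrt (1 - s * y\<^sup>2)) (at y)"
    and t: "0 \<le> t" "t \<le> 1"
  shows "((\<lambda>x. F (t * x) * arccos x / x) has_integral
      (\<Sum>k. s ^ k / real (2 * k + 1) ^ 3 * t ^ (2 * k + 1))) {0..1}"
proof -
  define b :: "nat \<Rightarrow> real" where "b n = (if odd n then s ^ (n div 2) else 0)" for n
  let ?f = "\<lambda>n. b (n + 1) / real (n + 1) ^ 3 * t ^ (n + 1)"
  let ?L = "\<Sum>k. s ^ k / real (2 * k + 1) ^ 3 * t ^ (2 * k + 1)"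
  have "summable (\<lambda>k. s ^ k * t ^ (2 * k + 1) / real (2 * k + 1) ^ 3)"
  proof (rule summable_comparison_test')
    show "summable (\<lambda>k. 1 / real (k + 1) ^ 3)"
      using summable_div_cube[of "\<lambda>_. 1" 1] by simp
    show "norm (s ^ k * t ^ (2 * k + 1) / real (2 * k + 1) ^ 3) \<le> 1 / real (k + 1) ^ 3" for k
    proof -
      have "\<bar>s ^ k * t ^ (2 * k + 1)\<bar> \<le> 1"
        unfolding abs_mult power_abs using s t by (intro mult_le_one power_le_one) auto
      then show ?thesis by (auto simp: abs_divide intro!: frac_le power_mono)
    qed
  qed
  then have "(\<lambda>k. s ^ k / real (2 * k + 1) ^ 3 * t ^ (2 * k + 1)) sums ?L"
    by (simp add: summable_sums)
  then have "(\<lambda>k. ?f (2 * k)) sums ?L"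
    by (simp add: b_def)
  then have "?f sums ?L"
    by (rule sums_even_indices[of ?f]) (simp add: b_def)
  moreover have "b (n + 3) = s * b (n + 1)" for n
    by (auto simp: b_def elim!: evenE)
  ultimately show ?thesis
    using has_integral_arc_quadratic[OF s F0 F' t, of b 1 0 ?L] by (simp add: b_def)
qed

text \<open>
  For \<open>p = 0\<close> and \<open>c = 1\<close> only even powers of \<open>t\<close> survive. The factor \<open>pi / 16\<close> is
  the initial value \<open>b 2 = pi / 2\<close> divided by the \<open>8\<close> in \<open>(2 k + 2)\<^sup>3 = 8 (k + 1)\<^sup>3\<close>.
\<close>
lemma has_integral_arc_square:
  fixes F :: "real \<Rightarrow> real"
  assumes s: "\<bar>s\<bar> \<le> 1" and F0: "F 0 = 0"
    and F': "\<And>y. \<bar>y\<bar> < 1 \<Longrightarrow> (F has_real_derivative 1 / sqrt (1 - s * y\<^sup>2)) (at y)"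
    and t: "0 \<le> t" "t \<le> 1"
  shows "((\<lambda>x. (1 / 2) * (F (t * x))\<^sup>2 * arccos x / x) has_integral
      (pi / 16 * (\<Sum>k. s ^ k * (t\<^sup>2) ^ (k + 1) / real (k + 1) ^ 3))) {0..1}"
proof -
  define b :: "nat \<Rightarrow> real" where "b n = (if even n then pi / 2 * s ^ (n div 2 - 1) else 0)" for n
  let ?f = "\<lambda>n. b (n + 1) / real (n + 1) ^ 3 * t ^ (n + 1)"
  let ?L = "\<Sum>k. s ^ k * (t\<^sup>2) ^ (k + 1) / real (k + 1) ^ 3"
  have "\<bar>s ^ k * (t\<^sup>2) ^ (k + 1)\<bar> \<le> 1" for k
    unfolding abs_mult power_abs using s t by (intro mult_le_one power_le_one) auto
  then have "(\<lambda>k. s ^ k * (t\<^sup>2) ^ (k + 1) / real (k + 1) ^ 3) sums ?L"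
    by (intro summable_sums summable_div_cube)
  then have "(\<lambda>k. pi / 16 * (s ^ k * (t\<^sup>2) ^ (k + 1) / real (k + 1) ^ 3)) sums (pi / 16 * ?L)"
    by (rule sums_mult)
  also have "(\<lambda>k. pi / 16 * (s ^ k * (t\<^sup>2) ^ (k + 1) / real (k + 1) ^ 3)) = (\<lambda>k. ?f (2 * k + 1))"
  proof
    fix k
    have "real (2 * k + 1 + 1) ^ 3 = 8 * real (k + 1) ^ 3"
      by (simp add: power3_eq_cube algebra_simps)
    moreover have "t ^ (2 * k + 1 + 1) = (t\<^sup>2) ^ (k + 1)"
      unfolding power_mult[symmetric] by simp
    moreover have "b (2 * k + 1 + 1) = pi / 2 * s ^ k" by (simp add: b_def)
    ultimately show "pi / 16 * (s ^ k * (t\<^sup>2) ^ (k + 1) / real (k + 1) ^ 3) = ?f (2 * k + 1)"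
      by (simp only:) simp
  qed
  finally have "?f sums (pi / 16 * ?L)"
    by (rule sums_odd_indices[of ?f]) (simp add: b_def)
  moreover have "b (n + 3) = s * b (n + 1)" for n
  proof (cases "even n")
    case False
    then obtain k where "n = 2 * k + 1" by (elim oddE)
    then show ?thesis by (simp add: b_def)
  qed (simp add: b_def)
  ultimately show ?thesis
    using has_integral_arc_quadratic[OF s F0 F' t, of b 0 1 "pi / 16 * ?L"] by (simp add: b_def)
qed

section \<open>The trilogarithm integrals\<close>

lemma Li3_sums:
  assumes "\<bar>u\<bar> \<le> 1"
  shows "(\<lambda>n. u ^ (n + 1) / real (n + 1) ^ 3) sums Li3 u"
proof -
  have "\<bar>u ^ (n + 1)\<bar> \<le> 1" for n
    unfolding power_abs using assms by (intro power_le_one) auto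
  then show ?thesis
    unfolding Li3_def by (intro summable_sums summable_div_cube)
qed

text \<open>
  The difference between \<open>Li3 u\<close> and the alternating series is twice the sum over the even powers
  of \<open>u\<close>, which is \<open>Li3 (u\<^sup>2) / 8\<close>.
\<close>
lemma alternating_Li3:
  assumes "\<bar>u\<bar> \<le> 1"
  shows "(\<Sum>k. (-1) ^ k * u ^ (k + 1) / real (k + 1) ^ 3) = Li3 u - Li3 (u\<^sup>2) / 4"
proof -
  let ?f = "\<lambda>k. (if odd k then 2 * u ^ (k + 1) / real (k + 1) ^ 3 else 0)"
  have "\<bar>u\<^sup>2\<bar> \<le> 1" using assms by (simp add: abs_square_le_1)
  from sums_divide[OF Li3_sums[OF this], of 4]
  have "(\<lambda>k. (u\<^sup>2) ^ (k + 1) / real (k + 1) ^ 3 / 4) sums (Li3 (u\<^sup>2) / 4)" .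
  also have "(\<lambda>k. (u\<^sup>2) ^ (k + 1) / real (k + 1) ^ 3 / 4) = (\<lambda>k. ?f (2 * k + 1))"
  proof
    fix k
    have "real (2 * k + 1 + 1) ^ 3 = 8 * real (k + 1) ^ 3"
      by (simp add: power3_eq_cube algebra_simps)
    moreover have "u ^ (2 * k + 1 + 1) = (u\<^sup>2) ^ (k + 1)"
      unfolding power_mult[symmetric] by simp
    ultimately show "(u\<^sup>2) ^ (k + 1) / real (k + 1) ^ 3 / 4 = ?f (2 * k + 1)"
      by (simp only:) simp
  qed
  finally have "?f sums (Li3 (u\<^sup>2) / 4)"
    by (rule sums_odd_indices[of ?f]) simp
  from sums_diff[OF Li3_sums[OF assms] this]
  have "(\<lambda>k. u ^ (k + 1) / real (k + 1) ^ 3 - ?f k) sums (Li3 u - Li3 (u\<^sup>2) / 4)" .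
  also have "(\<lambda>k. u ^ (k + 1) / real (k + 1) ^ 3 - ?f k)
      = (\<lambda>k. (-1) ^ k * u ^ (k + 1) / real (k + 1) ^ 3)"
    by (auto simp: fun_eq_iff)
  finally show ?thesis by (rule sums_unique[symmetric])
qed

theorem theorem3p4:
  fixes t :: real
  assumes "0 \<le> t" and "t \<le> 1"
  shows "((\<lambda>x. arcsin (t * x) * arccos x / x) integrable_on {0..1} \<and>
         chi3 t = integral {0..1} (\<lambda>x. arcsin (t * x) * arccos x / x)) \<and>
         ((\<lambda>x. (1 / 2) * (arcsin (t * x))\<^sup>2 * arccos x / x) integrable_on {0..1} \<and>
         (1 / 8) * Li3 (t\<^sup>2) =
           (2 / pi) * integral {0..1} (\<lambda>x. (1 / 2) * (arcsin (t * x))\<^sup>2 * arccos x / x)) \<and>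
         ((\<lambda>x. (arcsin (t * x) + (1 / pi) * (arcsin (t * x))\<^sup>2) * arccos x / x) integrable_on {0..1} \<and>
         Li3 t =
           integral {0..1} (\<lambda>x. (arcsin (t * x) + (1 / pi) * (arcsin (t * x))\<^sup>2) * arccos x / x)) \<and>
         ((\<lambda>x. arsinh (t * x) * arccos x / x) integrable_on {0..1} \<and>
         Ti3 t = integral {0..1} (\<lambda>x. arsinh (t * x) * arccos x / x)) \<and>
         ((\<lambda>x. (1 / 2) * (arsinh (t * x))\<^sup>2 * arccos x / x) integrable_on {0..1} \<and>
         (pi / 2) * ((1 / 8) * Li3 (t\<^sup>2) - (1 / 32) * Li3 (t ^ 4)) =
           integral {0..1} (\<lambda>x. (1 / 2) * (arsinh (t * x))\<^sup>2 * arccos x / x))"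
proof -
  have as: "(arcsin has_real_derivative 1 / sqrt (1 - 1 * y\<^sup>2)) (at y)" if "\<bar>y\<bar> < 1" for y
    using that by (auto intro!: derivative_eq_intros simp: abs_less_iff field_simps)
  have ash: "(arsinh has_real_derivative 1 / sqrt (1 - (-1) * y\<^sup>2)) (at y)" for y :: real
    using arsinh_real_has_field_derivative[of y UNIV] by (simp add: add.commute)
  have one: "((\<lambda>x. arcsin (t * x) * arccos x / x) has_integral chi3 t) {0..1}"
    using has_integral_arc[of 1 arcsin t] as assms by (simp add: chi3_def)
  have two: "((\<lambda>x. (1 / 2) * (arcsin (t * x))\<^sup>2 * arccos x / x) has_integral pi / 16 * Li3 (t\<^sup>2)) {0..1}"
    using has_integral_arc_square[of 1 arcsin t] as assms by (simp add: Li3_def)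
  \<comment> \<open>The constant \<open>c = 2 / pi\<close> makes \<open>b 2 = pi / 2 * c\<close> equal to \<open>b 1 = 1\<close>.\<close>
  have three: "((\<lambda>x. (arcsin (t * x) + (1 / pi) * (arcsin (t * x))\<^sup>2) * arccos x / x) has_integral Li3 t) {0..1}"
    using has_integral_arc_quadratic[of 1 arcsin t "\<lambda>_. 1" 1 "2 / pi" "Li3 t"] as assms Li3_sums[of t] by simp
  have four: "((\<lambda>x. arsinh (t * x) * arccos x / x) has_integral Ti3 t) {0..1}"
    using has_integral_arc[of "-1" arsinh t] ash assms by (simp add: Ti3_def)
  have "\<bar>t\<^sup>2\<bar> \<le> 1" using assms by (simp add: power_le_one)
  from alternating_Li3[OF this]
  have five: "((\<lambda>x. (1 / 2) * (arsinh (t * x))\<^sup>2 * arccos x / x) has_integral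
      pi / 16 * (Li3 (t\<^sup>2) - Li3 (t ^ 4) / 4)) {0..1}"
    using has_integral_arc_square[of "-1" arsinh t] ash assms by (simp flip: power_mult)
  have two': "(1 / 8) * Li3 (t\<^sup>2) = (2 / pi) * (pi / 16 * Li3 (t\<^sup>2))" by simp
  have five': "(pi / 2) * ((1 / 8) * Li3 (t\<^sup>2) - (1 / 32) * Li3 (t ^ 4))
      = pi / 16 * (Li3 (t\<^sup>2) - Li3 (t ^ 4) / 4)" by (simp add: field_simps)
  show ?thesis
    unfolding integral_unique[OF one] integral_unique[OF two] integral_unique[OF three]
      integral_unique[OF four] integral_unique[OF five]
    by (intro conjI refl two' five' has_integral_integrable[OF one] has_integral_integrable[OF two]
      has_integral_integrable[OF three] has_integral_integrable[OF four]
      has_integral_integrable[OF five])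
qed

end
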